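(* For every SLP $G$ of size $|G|=g$ representing a string $T\in\Sigma^n$, and any constant $\epsilon>0$, there exists a data structure of size $\mathcal{O}(g\cdot\log^{1+\epsilon} n)$ that, given any $i\in[1..n]$, returns $T[i]$ in $\mathcal{O}\!\left(\frac{\log n}{\log\log n}\right)$ time.
   Context: An SLP (straight-line program) is $G=(V,\Sigma,R,S)$ with finite disjoint sets $V$ (nonterminals) and $\Sigma$ (terminals) and $S\in V$; every $N\in V$ has exactly one rule $N\to\mathrm{rhs}(N)$ with $\mathrm{rhs}(N)\in\Sigma$ or $\mathrm{rhs}(N)=AB$ with $A,B\in V$, and there is an ordering $N_1,\dots,N_{|V|}$ of $V$ such that $\mathrm{rhs}(N_i)$ uses only nonterminals $N_j$ with $j>i$. The expansion $\mathrm{exp}(N)$ is the unique terminal string derived from $N$; $G$ represents $T=\mathrm{exp}(S)$. Size: $|G|=\sum_{N\in V}\max(|\mathrm{rhs}(N)|,1)$. Space is measured in machine words, time in word-RAM operations. *)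

theory Defs
  imports Complex_Main
begin

section \<open>Straight-line programs\<close>

record 's slp =
  nonterms :: "'s set"
  terms :: "'s set"
  rules :: "('s \<times> 's list) set"
  start :: 's

definition rhs :: "'s slp \<Rightarrow> 's \<Rightarrow> 's list" where
  "rhs G N = (THE \<alpha>. (N, \<alpha>) \<in> rules G)"

definition is_slp :: "'s slp \<Rightarrow> bool" where
  "is_slp G \<longleftrightarrow>
     finite (nonterms G) \<and> finite (terms G) \<and> nonterms G \<inter> terms G = {} \<and>
     start G \<in> nonterms G \<and>
     fst ` rules G \<subseteq> nonterms G \<and>
     (\<forall>N\<in>nonterms G. \<exists>!\<alpha>. (N, \<alpha>) \<in> rules G) \<and>
     (\<forall>N\<in>nonterms G. (\<exists>a\<in>terms G. rhs G N = [a]) \<or>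
                       (\<exists>A\<in>nonterms G. \<exists>B\<in>nonterms G. rhs G N = [A, B])) \<and>
     (\<exists>Ns. distinct Ns \<and> set Ns = nonterms G \<and>
           (\<forall>i<length Ns. \<forall>j<length Ns. Ns ! j \<in> set (rhs G (Ns ! i)) \<longrightarrow> i < j))"

definition slp_size :: "'s slp \<Rightarrow> nat" where
  "slp_size G = (\<Sum>N\<in>nonterms G. max (length (rhs G N)) 1)"

definition derives1 :: "'s slp \<Rightarrow> 's list \<Rightarrow> 's list \<Rightarrow> bool" where
  "derives1 G u v \<longleftrightarrow> (\<exists>x N \<alpha> y. (N, \<alpha>) \<in> rules G \<and> u = x @ [N] @ y \<and> v = x @ \<alpha> @ y)"

definition expansion :: "'s slp \<Rightarrow> 's \<Rightarrow> 's list" where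
  "expansion G N = (THE t. set t \<subseteq> terms G \<and> (derives1 G)\<^sup>*\<^sup>* [N] t)"

definition slp_string :: "'s slp \<Rightarrow> 's list" where
  "slp_string G = expansion G (start G)"

text \<open>The expansion is well defined.\<close>

lemma derives_append:
  assumes "(derives1 G)\<^sup>*\<^sup>* u u'" "(derives1 G)\<^sup>*\<^sup>* v v'"
  shows "(derives1 G)\<^sup>*\<^sup>* (u @ v) (u' @ v')"
proof -
  have l: "derives1 G (a @ v) (b @ v)" if "derives1 G a b" for a b v
    using that unfolding derives1_def by (metis append.assoc)
  have r: "derives1 G (v @ a) (v @ b)" if "derives1 G a b" for a b v
    using that unfolding derives1_def by (metis append.assoc)
  have "(derives1 G)\<^sup>*\<^sup>* (u @ v) (u' @ v)"
    using assms(1) by induction (auto intro: l rtranclp.rtrancl_into_rtrancl)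
  moreover have "(derives1 G)\<^sup>*\<^sup>* (u' @ v) (u' @ v')"
    using assms(2) by induction (auto intro: r rtranclp.rtrancl_into_rtrancl)
  ultimately show ?thesis by simp
qed

lemma derives_append_split:
  assumes "(derives1 G)\<^sup>*\<^sup>* (u @ v) t"
  shows "\<exists>t1 t2. t = t1 @ t2 \<and> (derives1 G)\<^sup>*\<^sup>* u t1 \<and> (derives1 G)\<^sup>*\<^sup>* v t2"
  using assms
proof (induction rule: rtranclp_induct)
  case base
  then show ?case by blast
next
  case (step y z)
  then obtain t1 t2 where t: "y = t1 @ t2" "(derives1 G)\<^sup>*\<^sup>* u t1" "(derives1 G)\<^sup>*\<^sup>* v t2"
    by blast
  obtain p N \<alpha> q where *: "(N, \<alpha>) \<in> rules G" "t1 @ t2 = p @ N # q" "z = p @ \<alpha> @ q"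
    using step(2) t(1) unfolding derives1_def by auto
  from *(2) consider (left) r where "t1 = p @ N # r" "q = r @ t2"
    | (right) r where "p = t1 @ r" "t2 = r @ N # q"
    by (auto simp: append_eq_append_conv2 append_eq_Cons_conv Cons_eq_append_conv)
  then show ?case
  proof cases
    case left
    then have "derives1 G t1 (p @ \<alpha> @ r)" using *(1) unfolding derives1_def by auto
    then have "(derives1 G)\<^sup>*\<^sup>* u (p @ \<alpha> @ r)"
      using t(2) by (rule rtranclp.rtrancl_into_rtrancl[rotated])
    moreover have "z = (p @ \<alpha> @ r) @ t2" using * left by simp
    ultimately show ?thesis using t(3) by blast
  next
    case right
    then have "derives1 G t2 (r @ \<alpha> @ q)" using *(1) unfolding derives1_def by auto
    then have "(derives1 G)\<^sup>*\<^sup>* v (r @ \<alpha> @ q)"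
      using t(3) by (rule rtranclp.rtrancl_into_rtrancl[rotated])
    moreover have "z = t1 @ (r @ \<alpha> @ q)" using * right by simp
    ultimately show ?thesis using t(2) by blast
  qed
qed

lemma rhs_rule:
  assumes "is_slp G" "N \<in> nonterms G"
  shows "(N, \<alpha>) \<in> rules G \<longleftrightarrow> \<alpha> = rhs G N"
proof -
  have "\<exists>!\<alpha>. (N, \<alpha>) \<in> rules G" using assms unfolding is_slp_def by blast
  then show ?thesis unfolding rhs_def by (metis (mono_tags, lifting) theI')
qed

lemma derives_terminals:
  assumes "is_slp G" "(derives1 G)\<^sup>*\<^sup>* u t" "set u \<subseteq> terms G"
  shows "t = u"
proof -
  have "\<not> derives1 G u v" for v
  proof
    assume "derives1 G u v"
    then obtain x N \<alpha> y where "(N, \<alpha>) \<in> rules G" "u = x @ [N] @ y"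
      unfolding derives1_def by blast
    moreover have "fst ` rules G \<subseteq> nonterms G" "nonterms G \<inter> terms G = {}"
      using assms(1) unfolding is_slp_def by blast+
    ultimately show False using assms(3) by force
  qed
  then show ?thesis using assms(2) by (metis converse_rtranclpE)
qed

lemma derives_nonterm:
  assumes "is_slp G" "N \<in> nonterms G" "set t \<subseteq> terms G"
  shows "(derives1 G)\<^sup>*\<^sup>* [N] t \<longleftrightarrow> (derives1 G)\<^sup>*\<^sup>* (rhs G N) t"
proof
  assume l: "(derives1 G)\<^sup>*\<^sup>* [N] t"
  have "nonterms G \<inter> terms G = {}" using assms(1) unfolding is_slp_def by blast
  then have "t \<noteq> [N]" using assms(2,3) by auto
  then obtain u where u: "derives1 G [N] u" "(derives1 G)\<^sup>*\<^sup>* u t"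
    using l by (metis converse_rtranclpE)
  from u(1) have "(N, u) \<in> rules G"
    unfolding derives1_def by (auto simp: Cons_eq_append_conv)
  then show "(derives1 G)\<^sup>*\<^sup>* (rhs G N) t" using u(2) assms rhs_rule by metis
next
  assume r: "(derives1 G)\<^sup>*\<^sup>* (rhs G N) t"
  have "(N, rhs G N) \<in> rules G" using assms rhs_rule by metis
  then have "derives1 G [N] (rhs G N)"
    unfolding derives1_def by (metis append_Nil append_Nil2)
  then show "(derives1 G)\<^sup>*\<^sup>* [N] t" using r by (rule converse_rtranclp_into_rtranclp)
qed

lemma expansion_ex1:
  assumes G: "is_slp G" and N: "N \<in> nonterms G"
  shows "\<exists>!t. set t \<subseteq> terms G \<and> (derives1 G)\<^sup>*\<^sup>* [N] t"
proof -
  obtain Ns where Ns: "set Ns = nonterms G"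
    and order: "\<And>i j. i < length Ns \<Longrightarrow> j < length Ns \<Longrightarrow> Ns ! j \<in> set (rhs G (Ns ! i)) \<Longrightarrow> i < j"
    using G unfolding is_slp_def by blast
  have "\<exists>!t. set t \<subseteq> terms G \<and> (derives1 G)\<^sup>*\<^sup>* [Ns ! i] t" if "i < length Ns" for i
    using that
  proof (induction "length Ns - i" arbitrary: i rule: less_induct)
    case less
    let ?N = "Ns ! i"
    have N: "?N \<in> nonterms G" unfolding Ns[symmetric] by (rule nth_mem) (rule less.prems(1))
    have IH: "\<exists>!t. set t \<subseteq> terms G \<and> (derives1 G)\<^sup>*\<^sup>* [A] t"
      if A: "A \<in> nonterms G" "A \<in> set (rhs G ?N)" for A
    proof -
      obtain j where j: "j < length Ns" "A = Ns ! j" using A(1) Ns by (metis in_set_conv_nth)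
      then have "i < j" using order less.prems A(2) by blast
      then show ?thesis using less.hyps[of j] j by simp
    qed
    consider (t) a where "a \<in> terms G" "rhs G ?N = [a]"
      | (n) A B where "A \<in> nonterms G" "B \<in> nonterms G" "rhs G ?N = [A] @ [B]"
    proof -
      have "(\<exists>a\<in>terms G. rhs G ?N = [a]) \<or> (\<exists>A\<in>nonterms G. \<exists>B\<in>nonterms G. rhs G ?N = [A, B])"
        using G N unfolding is_slp_def by blast
      then show ?thesis using that by auto
    qed
    then show ?case
    proof cases
      case t
      have 1: "set [a] \<subseteq> terms G \<and> (derives1 G)\<^sup>*\<^sup>* [?N] [a]"
        using derives_nonterm[OF G N, of "[a]"] t by simp
      have 2: "v = [a]" if v: "set v \<subseteq> terms G" "(derives1 G)\<^sup>*\<^sup>* [?N] v" for v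
      proof -
        have "(derives1 G)\<^sup>*\<^sup>* [a] v" using derives_nonterm[OF G N v(1)] v(2) t(2) by simp
        then show ?thesis using t(1) by (intro derives_terminals[OF G]) simp_all
      qed
      show ?thesis by (rule ex1I[where a = "[a]"]) (use 1 2 in blast)+
    next
      case n
      have ex1A: "\<exists>!t. set t \<subseteq> terms G \<and> (derives1 G)\<^sup>*\<^sup>* [A] t"
        by (rule IH) (simp_all add: n)
      have ex1B: "\<exists>!t. set t \<subseteq> terms G \<and> (derives1 G)\<^sup>*\<^sup>* [B] t"
        by (rule IH) (simp_all add: n)
      obtain x where x: "set x \<subseteq> terms G" "(derives1 G)\<^sup>*\<^sup>* [A] x"
        "\<And>v. set v \<subseteq> terms G \<Longrightarrow> (derives1 G)\<^sup>*\<^sup>* [A] v \<Longrightarrow> v = x"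
        using ex1A unfolding Ex1_def by blast
      obtain y where y: "set y \<subseteq> terms G" "(derives1 G)\<^sup>*\<^sup>* [B] y"
        "\<And>v. set v \<subseteq> terms G \<Longrightarrow> (derives1 G)\<^sup>*\<^sup>* [B] v \<Longrightarrow> v = y"
        using ex1B unfolding Ex1_def by blast
      have "(derives1 G)\<^sup>*\<^sup>* ([A] @ [B]) (x @ y)" by (rule derives_append[OF x(2) y(2)])
      then have 1: "set (x @ y) \<subseteq> terms G \<and> (derives1 G)\<^sup>*\<^sup>* [?N] (x @ y)"
        using derives_nonterm[OF G N, of "x @ y"] n(3) x(1) y(1) by simp
      have 2: "v = x @ y" if v: "set v \<subseteq> terms G" "(derives1 G)\<^sup>*\<^sup>* [?N] v" for v
      proof -
        have "(derives1 G)\<^sup>*\<^sup>* ([A] @ [B]) v" using derives_nonterm[OF G N v(1)] v n by simp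
        then obtain t1 t2 where "v = t1 @ t2" "(derives1 G)\<^sup>*\<^sup>* [A] t1" "(derives1 G)\<^sup>*\<^sup>* [B] t2"
          using derives_append_split by blast
        then show ?thesis using x(3)[of t1] y(3)[of t2] v(1) by simp
      qed
      show ?thesis by (rule ex1I[where a = "x @ y"]) (use 1 2 in blast)+
    qed
  qed
  moreover obtain i where "i < length Ns" "N = Ns ! i"
    using N Ns by (metis in_set_conv_nth)
  ultimately show ?thesis by blast
qed

section \<open>Word RAM\<close>

text \<open>
  A word of a machine with word size \<^term>\<open>w\<close> is a natural number below \<^term>\<open>(2::nat) ^ w\<close>.
  Registers are named statically, so a program uses a constant number of them; memory is
  addressed by register contents. Every instruction takes unit time.
\<close>

datatype binop =
  Add | Sub | Mul | Div | Mod | And | Or | Xor | Shl | Shr | Less | Equal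

datatype instr =
    Const nat nat            (* Const r c: r := c *)
  | Copy nat nat             (* Copy r a: r := a *)
  | Op binop nat nat nat     (* Op f r a b: r := f a b *)
  | Load nat nat             (* Load r a: r := mem[a] *)
  | Store nat nat            (* Store a b: mem[a] := b *)
  | Jump nat
  | JumpZero nat nat         (* JumpZero a l: goto l if a = 0 *)
  | Halt

context
  includes bit_operations_syntax
begin

fun binop_sem :: "nat \<Rightarrow> binop \<Rightarrow> nat \<Rightarrow> nat \<Rightarrow> nat" where
  "binop_sem w Add a b = (a + b) mod 2 ^ w"
| "binop_sem w Sub a b = (2 ^ w + a - b) mod 2 ^ w"
| "binop_sem w Mul a b = (a * b) mod 2 ^ w"
| "binop_sem w Div a b = a div b"
| "binop_sem w Mod a b = a mod b"
| "binop_sem w And a b = a AND b"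
| "binop_sem w Or a b = a OR b"
| "binop_sem w Xor a b = a XOR b"
| "binop_sem w Shl a b = (a * 2 ^ b) mod 2 ^ w"
| "binop_sem w Shr a b = a div 2 ^ b"
| "binop_sem w Less a b = (if a < b then 1 else 0)"
| "binop_sem w Equal a b = (if a = b then 1 else 0)"

end

record config =
  pc :: nat
  reg :: "nat \<Rightarrow> nat"
  mem :: "nat \<Rightarrow> nat"

fun exec :: "nat \<Rightarrow> instr \<Rightarrow> config \<Rightarrow> config" where
  "exec w (Const r c) s = s\<lparr>pc := pc s + 1, reg := (reg s)(r := c mod 2 ^ w)\<rparr>"
| "exec w (Copy r a) s = s\<lparr>pc := pc s + 1, reg := (reg s)(r := reg s a)\<rparr>"
| "exec w (Op f r a b) s =
     s\<lparr>pc := pc s + 1, reg := (reg s)(r := binop_sem w f (reg s a) (reg s b))\<rparr>"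
| "exec w (Load r a) s = s\<lparr>pc := pc s + 1, reg := (reg s)(r := mem s (reg s a))\<rparr>"
| "exec w (Store a b) s = s\<lparr>pc := pc s + 1, mem := (mem s)(reg s a := reg s b)\<rparr>"
| "exec w (Jump l) s = s\<lparr>pc := l\<rparr>"
| "exec w (JumpZero a l) s = s\<lparr>pc := (if reg s a = 0 then l else pc s + 1)\<rparr>"
| "exec w Halt s = s"

definition halted :: "instr list \<Rightarrow> config \<Rightarrow> bool" where
  "halted P s \<longleftrightarrow> pc s \<ge> length P \<or> P ! pc s = Halt"

definition step :: "nat \<Rightarrow> instr list \<Rightarrow> config \<Rightarrow> config" where
  "step w P s = (if halted P s then s else exec w (P ! pc s) s)"

text \<open>
  Started with the words \<^term>\<open>D\<close> at addresses \<open>0, 1, \<dots>\<close> (and arbitrary words in the remaining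
  memory) and the argument \<^term>\<open>i\<close> in register \<open>0\<close>, the program halts after at most \<^term>\<open>t\<close>
  steps with result \<^term>\<open>x\<close> in register \<open>0\<close>, and \<^term>\<open>D\<close> is still intact, i.e. ready for
  further queries.
\<close>

definition query_returns ::
  "nat \<Rightarrow> instr list \<Rightarrow> nat list \<Rightarrow> nat \<Rightarrow> nat \<Rightarrow> nat \<Rightarrow> bool" where
  "query_returns w P D i x t \<longleftrightarrow>
     (\<forall>m. (\<forall>k. m k < 2 ^ w) \<and> (\<forall>k<length D. m k = D ! k) \<longrightarrow>
       (let s = (step w P ^^ t) \<lparr>pc = 0, reg = (\<lambda>_. 0)(0 := i), mem = m\<rparr>
        in halted P s \<and> reg s 0 = x \<and> (\<forall>k<length D. mem s k = D ! k)))"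

section \<open>Logarithms in asymptotic bounds\<close>

text \<open>
  In asymptotic bounds we need \<open>log n\<close> and \<open>log log n\<close>, which vanish or are undefined for
  \<open>n \<le> 2\<close>. As usual, logarithms are read as being at least \<open>1\<close>; for \<open>n \<ge> 4\<close> we have
  \<open>lg n = log 2 n\<close> and \<open>lg (lg n) = log 2 (log 2 n)\<close>.
\<close>

definition lg :: "real \<Rightarrow> real" where
  "lg x = max 1 (log 2 x)"

end

theory Submission
  imports Defs
begin

text \<open>
  Mark, in one occurrence of every nonterminal in \<open>T\<close>, the position where its second half begins.
  The at most \<open>g\<close> marked positions form a string attractor: every substring of \<open>T\<close> has an
  occurrence containing a marked position, found in the lowest nonterminal whose expansion
  contains the substring. Fix a branching factor \<open>\<tau> \<approx> log\<^sup>\<epsilon> n\<close>. Around each marked position and for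
  each length \<open>q\<tau>\<close> that is a power of \<open>\<tau>\<close>, cut a window of length \<open>2q\<tau>\<close> into \<open>2\<tau>\<close> blocks of length
  \<open>q\<close>, and let each block point to an occurrence of it around some marked position, that is, into a
  window of length \<open>2q\<close>. Following the pointers shrinks the window by a factor \<open>\<tau>\<close> in constant time,
  so \<open>O(log n / log \<tau>)\<close> steps reach a single character. If this structure is longer than \<open>T\<close>,
  then \<open>T\<close> is stored explicitly instead, so that addresses always fit into a word.
\<close>

section \<open>String attractors of straight-line programs\<close>

definition attractor :: "'a list \<Rightarrow> nat set \<Rightarrow> bool" where
  "attractor T \<Gamma> \<longleftrightarrow>
     (\<forall>s l. 0 < l \<and> s + l \<le> length T \<longrightarrow>
        (\<exists>s'. \<exists>p\<in>\<Gamma>. s' \<le> p \<and> p < s' + l \<and> s' + l \<le> length T \<and>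
           (\<forall>k<l. T ! (s' + k) = T ! (s + k))))"

section \<open>Expansions and induction along the rules\<close>

lemma expansion_props:
  assumes "is_slp G" "N \<in> nonterms G"
  shows "set (expansion G N) \<subseteq> terms G" "(derives1 G)\<^sup>*\<^sup>* [N] (expansion G N)"
  using theI'[OF expansion_ex1[OF assms]] unfolding expansion_def by blast+

lemma expansion_eqI:
  assumes "is_slp G" "N \<in> nonterms G" "set t \<subseteq> terms G" "(derives1 G)\<^sup>*\<^sup>* (rhs G N) t"
  shows "expansion G N = t"
  unfolding expansion_def
  using assms derives_nonterm[OF assms(1-3)] by (intro the1_equality expansion_ex1) auto

lemma expansion_terminal:
  assumes "is_slp G" "N \<in> nonterms G" "a \<in> terms G" "rhs G N = [a]"
  shows "expansion G N = [a]"
  using assms by (intro expansion_eqI) auto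

lemma expansion_pair:
  assumes "is_slp G" "N \<in> nonterms G" "A \<in> nonterms G" "B \<in> nonterms G" "rhs G N = [A, B]"
  shows "expansion G N = expansion G A @ expansion G B"
proof (rule expansion_eqI[OF assms(1,2)])
  show "set (expansion G A @ expansion G B) \<subseteq> terms G"
    using expansion_props(1) assms by fastforce
  have "(derives1 G)\<^sup>*\<^sup>* ([A] @ [B]) (expansion G A @ expansion G B)"
    using assms by (intro derives_append expansion_props)
  then show "(derives1 G)\<^sup>*\<^sup>* (rhs G N) (expansion G A @ expansion G B)"
    by (simp add: assms(5))
qed

text \<open>The acyclic ordering of the nonterminals makes the rules well-founded; the induction
  runs on the distance to the end of that ordering.\<close>

lemma slp_induct [consumes 2, case_names terminal pair]:
  assumes G: "is_slp G" and N: "N \<in> nonterms G"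
    and terminal: "\<And>N a. N \<in> nonterms G \<Longrightarrow> a \<in> terms G \<Longrightarrow> rhs G N = [a] \<Longrightarrow> Q N"
    and pair: "\<And>N A B. N \<in> nonterms G \<Longrightarrow> A \<in> nonterms G \<Longrightarrow> B \<in> nonterms G \<Longrightarrow>
      rhs G N = [A, B] \<Longrightarrow> Q A \<Longrightarrow> Q B \<Longrightarrow> Q N"
  shows "Q N"
proof -
  obtain Ns where Ns: "set Ns = nonterms G"
    and order: "\<And>i j. i < length Ns \<Longrightarrow> j < length Ns \<Longrightarrow> Ns ! j \<in> set (rhs G (Ns ! i)) \<Longrightarrow> i < j"
    using G unfolding is_slp_def by blast
  have "Q (Ns ! i)" if "i < length Ns" for i
    using that
  proof (induction "length Ns - i" arbitrary: i rule: less_induct)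
    case less
    let ?N = "Ns ! i"
    have N: "?N \<in> nonterms G" using less.prems Ns nth_mem by blast
    have IH: "Q A" if A: "A \<in> nonterms G" "A \<in> set (rhs G ?N)" for A
    proof -
      obtain j where j: "j < length Ns" "A = Ns ! j" using A(1) Ns by (metis in_set_conv_nth)
      then have "i < j" using order less.prems A(2) by blast
      then show ?thesis using less.hyps[of j] j by simp
    qed
    have "(\<exists>a\<in>terms G. rhs G ?N = [a]) \<or> (\<exists>A\<in>nonterms G. \<exists>B\<in>nonterms G. rhs G ?N = [A, B])"
      using G N unfolding is_slp_def by blast
    then show ?case
    proof (elim disjE bexE)
      fix A B assume "A \<in> nonterms G" "B \<in> nonterms G" "rhs G ?N = [A, B]"
      then show ?thesis using pair[OF N, of A B] IH[of A] IH[of B] by simp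
    qed (use terminal[OF N] in blast)
  qed
  then show ?thesis using N Ns by (metis in_set_conv_nth)
qed

lemma card_nonterms_le_slp_size: "card (nonterms G) \<le> slp_size G"
proof -
  have "(\<Sum>N\<in>nonterms G. 1) \<le> slp_size G"
    unfolding slp_size_def by (intro sum_mono) simp
  then show ?thesis by simp
qed

lemma slp_attractor:
  assumes G: "is_slp G"
  shows "\<exists>\<Gamma>. finite \<Gamma> \<and> card \<Gamma> \<le> slp_size G \<and> attractor (slp_string G) \<Gamma>"
proof -
  define T where "T = slp_string G"
  let ?e = "expansion G"
  define occ where "occ N o' \<longleftrightarrow> o' + length (?e N) \<le> length T \<and>
    (\<forall>k<length (?e N). T ! (o' + k) = ?e N ! k)" for N o'
  \<comment> \<open>A nonterminal unreachable from the start symbol may have no occurrence in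
    \<open>T\<close>; its \<open>pos\<close> is then arbitrary, which costs at most one extra
    mark.\<close>
  define pos where "pos N = (SOME o'. occ N o')" for N
  have pos: "occ N (pos N)" if "occ N o'" for N o'
    unfolding pos_def by (rule someI[of "occ N", OF that])
  define mark where
    "mark N = pos N + (if length (rhs G N) = 2 then length (?e (hd (rhs G N))) else 0)" for N
  define \<Gamma> where "\<Gamma> = mark ` nonterms G"
  have fin: "finite (nonterms G)" and st: "start G \<in> nonterms G"
    using G unfolding is_slp_def by auto
  \<comment> \<open>All occurrences of \<open>N\<close> read the same string, so a substring of the
    one at \<open>o'\<close> recurs at the same offset in the chosen one at \<open>pos N\<close>,
    where it covers the mark.\<close>
  have cross: "\<exists>s'. \<exists>p\<in>\<Gamma>. s' \<le> p \<and> p < s' + l \<and> s' + l \<le> length T \<and>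
      (\<forall>k<l. T ! (s' + k) = T ! (s + k))"
    if N: "N \<in> nonterms G" and oc: "occ N o'" and sl: "o' \<le> s" "s + l \<le> o' + length (?e N)"
      and m: "pos N + (s - o') \<le> mark N" "mark N < pos N + (s - o') + l" for N o' s l
  proof (intro exI bexI conjI allI impI)
    show "mark N \<in> \<Gamma>" using N by (simp add: \<Gamma>_def)
    show "pos N + (s - o') + l \<le> length T"
      using pos[OF oc] sl unfolding occ_def by linarith
    fix k assume k: "k < l"
    then have *: "s - o' + k < length (?e N)" using sl by simp
    have "T ! (pos N + (s - o' + k)) = ?e N ! (s - o' + k)"
      using pos[OF oc] * unfolding occ_def by blast
    also have "\<dots> = T ! (o' + (s - o' + k))"
      using oc * unfolding occ_def by metis
    finally show "T ! (pos N + (s - o') + k) = T ! (s + k)"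
      using sl by (simp add: add.assoc)
  qed (use m in auto)
  have main: "\<exists>s'. \<exists>p\<in>\<Gamma>. s' \<le> p \<and> p < s' + l \<and> s' + l \<le> length T \<and>
      (\<forall>k<l. T ! (s' + k) = T ! (s + k))"
    if "N \<in> nonterms G" "occ N o'" "0 < l" "o' \<le> s" "s + l \<le> o' + length (?e N)" for N o' s l
    using G that
  proof (induction N arbitrary: o' rule: slp_induct)
    case (terminal N a)
    then have "mark N = pos N" "length (?e N) = 1"
      using expansion_terminal[OF G] unfolding mark_def by auto
    then show ?case using terminal by (intro cross[of N o']) auto
  next
    case (pair N A B)
    have e: "?e N = ?e A @ ?e B" using expansion_pair[OF G] pair.hyps by blast
    have m: "mark N = pos N + length (?e A)" using pair.hyps by (simp add: mark_def)
    consider "s + l \<le> o' + length (?e A)" | "o' + length (?e A) \<le> s"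
      | "s < o' + length (?e A)" "o' + length (?e A) < s + l" by linarith
    then show ?case
    proof cases
      case 1
      have "T ! (o' + k) = ?e A ! k" if "k < length (?e A)" for k
        using pair.prems(1) that unfolding occ_def e by (simp add: nth_append)
      then have "occ A o'" using pair.prems(1) unfolding occ_def e by simp
      then show ?thesis using pair.IH(1) pair.prems 1 by blast
    next
      case 2
      have "T ! (o' + length (?e A) + k) = ?e B ! k" if "k < length (?e B)" for k
      proof -
        have "length (?e A) + k < length (?e N)" using that by (simp add: e)
        then have "T ! (o' + (length (?e A) + k)) = ?e N ! (length (?e A) + k)"
          using pair.prems(1) unfolding occ_def by blast
        then show ?thesis by (simp add: e add.assoc)
      qed
      then have "occ B (o' + length (?e A))" using pair.prems(1) unfolding occ_def e by simp
      then show ?thesis using pair.IH(2) pair.prems 2 by (simp add: e)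
    next
      case 3
      then show ?thesis using pair.prems pair.hyps m by (intro cross[of N o']) auto
    qed
  qed
  have "occ (start G) 0" unfolding occ_def T_def slp_string_def by simp
  then have "attractor T \<Gamma>"
    unfolding attractor_def using main[OF st, of 0] by (auto simp: T_def slp_string_def)
  moreover have "card \<Gamma> \<le> slp_size G"
    unfolding \<Gamma>_def using card_image_le[OF fin, of mark] card_nonterms_le_slp_size[of G] by simp
  ultimately show ?thesis using fin unfolding \<Gamma>_def T_def by blast
qed

section \<open>The query program\<close>

text \<open>
  A zero at address \<open>0\<close> announces explicit storage. Otherwise addresses \<open>0\<close> and \<open>1\<close> hold the largest
  block length and the branching factor, and the tables begin at address \<open>2\<close>. In the loop, register
  \<open>0\<close> is the offset in the current window, register \<open>1\<close> the block length, register \<open>2\<close> the branching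
  factor, and register \<open>3\<close> the address of the current table; the last table yields a character there.
\<close>

definition access_prog :: "instr list" where
  "access_prog =
    [Load 1 1, JumpZero 1 19, Const 4 1, Load 2 4, Op Sub 0 0 4, Const 3 2,
     Op Div 5 0 1, Op Add 5 5 5, Op Add 3 3 5, Op Mod 0 0 1, Op Add 5 3 4, Load 5 5,
     Op Add 0 0 5, Load 3 3, Op Div 1 1 2, JumpZero 1 17, Jump 6,
     Copy 0 3, Halt,
     Load 0 0]"

text \<open>Position \<open>6\<close> is the loop head. Register \<open>4\<close> keeps the constant
  1; register \<open>5\<close> is scratch and left free.\<close>

definition loop_state :: "(nat \<Rightarrow> nat) \<Rightarrow> nat \<Rightarrow> nat \<Rightarrow> nat \<Rightarrow> nat \<Rightarrow> config \<Rightarrow> bool" where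
  "loop_state m \<tau> b q r s \<longleftrightarrow> pc s = 6 \<and> mem s = m \<and>
     reg s 0 = r \<and> reg s 1 = q \<and> reg s 2 = \<tau> \<and> reg s 3 = b \<and> reg s 4 = 1"

lemma step_not_halted [simp]:
  assumes "pc s < length P" "P ! pc s \<noteq> Halt"
  shows "step w P s = exec w (P ! pc s) s"
  using assms by (simp add: step_def halted_def)

text \<open>Registers start at 0, so the first load reads address \<open>0\<close>. Position
  \<open>20\<close> lies just past the program and counts as halted.\<close>

lemma access_prog_explicit:
  assumes "m 0 = 0"
  shows "(step w access_prog ^^ 3) \<lparr>pc = 0, reg = (\<lambda>_. 0)(0 := i), mem = m\<rparr> =
    \<lparr>pc = 20, reg = (\<lambda>_. 0)(0 := m i), mem = m\<rparr>"
  using assms by (auto simp: eval_nat_numeral access_prog_def fun_eq_iff)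

lemma access_prog_init:
  assumes "m 0 \<noteq> 0" "0 < i" "i < 2 ^ w" "2 < (2::nat) ^ w"
  shows "loop_state m (m 1) 2 (m 0) (i - 1)
    ((step w access_prog ^^ 6) \<lparr>pc = 0, reg = (\<lambda>_. 0)(0 := i), mem = m\<rparr>)"
proof -
  have "0 < w" using assms(4) by (cases w) auto
  moreover have "(2 ^ w + i - Suc 0) mod 2 ^ w = i - 1"
  proof -
    have "2 ^ w + i - Suc 0 = (i - 1) + 2 ^ w" using assms by simp
    then show ?thesis using assms(3) by (simp only: mod_add_self2) simp
  qed
  ultimately show ?thesis
    using assms by (simp add: eval_nat_numeral access_prog_def loop_state_def)
qed

text \<open>A round is the 11 instructions from the loop head to the jump back. A cell has two
  words, the address of the next table and a shift of the offset; the bounds rule out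
  overflow.\<close>

lemma access_prog_loop:
  assumes "loop_state m \<tau> b q r s"
    and "b + 2 * (r div q) + 1 < 2 ^ w"
    and "r mod q + m (b + 2 * (r div q) + 1) < 2 ^ w"
    and "q div \<tau> \<noteq> 0"
  shows "loop_state m \<tau> (m (b + 2 * (r div q))) (q div \<tau>) (r mod q + m (b + 2 * (r div q) + 1))
    ((step w access_prog ^^ 11) s)"
proof -
  have "1 < (2::nat) ^ w" using assms(2) by linarith
  then show ?thesis
    using assms unfolding loop_state_def
    by (simp add: eval_nat_numeral access_prog_def)
qed

text \<open>The copy of the result takes the place of the jump back, so the last round also costs 11
  steps.\<close>

lemma access_prog_exit:
  assumes "loop_state m \<tau> b q r s"
    and "b + 2 * (r div q) + 1 < 2 ^ w"
    and "q div \<tau> = 0"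
  shows "let s' = (step w access_prog ^^ 11) s
    in pc s' = 18 \<and> reg s' 0 = m (b + 2 * (r div q)) \<and> mem s' = m"
proof -
  have "1 < (2::nat) ^ w" using assms(2) by linarith
  then show ?thesis
    using assms unfolding loop_state_def
    by (simp add: eval_nat_numeral access_prog_def)
qed


section \<open>The data structure\<close>

text \<open>\<open>S\<close> counts two header words and, for each of \<open>L + 1\<close> levels
  and each entry of \<open>pts\<close>, a table of \<open>2 * \<tau>\<close> cells of two
  words.\<close>

lemma attractor_access_structure:
  fixes pts :: "nat list" and code :: "'a \<Rightarrow> nat" and \<tau> L w :: nat
  defines "S \<equiv> 2 + 4 * \<tau> * (length pts * (L + 1))"
  assumes attr: "attractor T (set pts)"
    and \<tau>: "2 \<le> \<tau>"
    and n_ge: "2 * \<tau> ^ L \<le> length T"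
    and n_less: "length T < 2 * \<tau> ^ (L + 1)"
    and S: "S \<le> length T"
    and w: "length T < 2 ^ w"
    and code: "code ` set T \<subseteq> {..<2 ^ w}"
  shows "\<exists>D. length D = S \<and> set D \<subseteq> {..<2 ^ w} \<and>
    (\<forall>i\<in>{1..length T}. query_returns w access_prog D i (code (T ! (i - 1))) (6 + 11 * (L + 1)))"
proof -
  define n where "n = length T"
  define \<gamma> where "\<gamma> = length pts"
  define q where "q k = \<tau> ^ (L - k)" for k
  have q_pos: "0 < q k" for k using \<tau> by (simp add: q_def)
  \<comment> \<open>An offset after a jump is below \<open>2 * q k\<close>, so this bound makes it
    fit into a word.\<close>
  have q_le: "2 * q k \<le> n" for k
  proof -
    have "q k \<le> \<tau> ^ L" unfolding q_def using \<tau> by (intro power_increasing) auto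
    then show ?thesis using n_ge by (simp add: n_def)
  qed
  have q_Suc: "q k = \<tau> * q (Suc k)" if "k < L" for k
    using that by (simp add: q_def Suc_diff_Suc flip: power_Suc)
  have n_pos: "2 \<le> n" using S by (simp add: S_def n_def)

  \<comment> \<open>The minimum truncates a block that overhangs the right end of
    \<open>T\<close>.\<close>
  have link: "\<exists>j s'. j < \<gamma> \<and> s' \<le> pts ! j \<and> pts ! j < s' + min (q k) (n - s) \<and>
      s' + min (q k) (n - s) \<le> n \<and> (\<forall>x<min (q k) (n - s). T ! (s' + x) = T ! (s + x))"
    if "s < n" for k s
  proof -
    have "0 < min (q k) (n - s)" "s + min (q k) (n - s) \<le> n" using q_pos that by auto
    then obtain s' p where "p \<in> set pts" "s' \<le> p" "p < s' + min (q k) (n - s)"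
      "s' + min (q k) (n - s) \<le> n" "\<forall>x<min (q k) (n - s). T ! (s' + x) = T ! (s + x)"
      using attr unfolding attractor_def n_def by blast
    then show ?thesis by (metis \<gamma>_def in_set_conv_nth)
  qed
  then have "\<forall>k s. \<exists>j s'. s < n \<longrightarrow> j < \<gamma> \<and> s' \<le> pts ! j \<and>
      pts ! j < s' + min (q k) (n - s) \<and> s' + min (q k) (n - s) \<le> n \<and>
      (\<forall>x<min (q k) (n - s). T ! (s' + x) = T ! (s + x))"
    by blast
  then obtain J O' where "\<forall>k s. s < n \<longrightarrow> J k s < \<gamma> \<and> O' k s \<le> pts ! J k s \<and>
      pts ! J k s < O' k s + min (q k) (n - s) \<and> O' k s + min (q k) (n - s) \<le> n \<and>
      (\<forall>x<min (q k) (n - s). T ! (O' k s + x) = T ! (s + x))"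
    unfolding choice_iff by blast
  then have JO: "J k s < \<gamma>" "O' k s \<le> pts ! J k s"
      "pts ! J k s < O' k s + min (q k) (n - s)" "O' k s + min (q k) (n - s) \<le> n"
      "x < min (q k) (n - s) \<Longrightarrow> T ! (O' k s + x) = T ! (s + x)" if "s < n" for k s x
    using that by blast+
  have \<gamma>_pos: "0 < \<gamma>" using JO(1)[of 0 0] n_pos by simp

  \<comment> \<open>A window starts \<open>q (k - 1)\<close> before its marked position; truncated subtraction clips it at the
    left end of \<open>T\<close>. The only window used on level \<open>0\<close> is all of \<open>T\<close>.\<close>
  define st where "st k j = (if k = 0 then 0 else pts ! j - q (k - 1))" for k j
  define base where "base k j = 2 + 4 * \<tau> * (k * \<gamma> + j)" for k j
  define ptr where "ptr k j c = (let s = st k j + c * q k in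
    if s < n then (if k < L then base (Suc k) (J k s) else code (T ! s)) else 0)" for k j c
  define shift where "shift k j c = (let s = st k j + c * q k in
    if s < n \<and> k < L then O' k s - st (Suc k) (J k s) else 0)" for k j c
  \<comment> \<open>This inverts the layout given by \<open>base\<close>: even addresses hold
    pointers, odd ones shifts.\<close>
  define cell where "cell a = (let y = (a - 2) div 2; t = y div (2 * \<tau>) in
    (if even a then ptr else shift) (t div \<gamma>) (t mod \<gamma>) (y mod (2 * \<tau>)))" for a
  \<comment> \<open>\<open>q 0\<close> is a power of \<open>\<tau>\<close>, hence nonzero, and so
    also announces that tables follow.\<close>
  define D where "D = map (\<lambda>a. if a = 0 then q 0 else if a = 1 then \<tau> else cell a) [0..<S]"
  have len: "length D = S" by (simp add: D_def)

  have base_bound: "base k j + 4 * \<tau> \<le> S" if "k \<le> L" "j < \<gamma>" for k j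
  proof -
    have "k * \<gamma> + j + 1 \<le> k * \<gamma> + \<gamma>" using that by simp
    also have "\<dots> \<le> L * \<gamma> + \<gamma>" using that by simp
    finally have "4 * \<tau> * (k * \<gamma> + j + 1) \<le> 4 * \<tau> * (\<gamma> * (L + 1))"
      by (intro mult_left_mono) (simp_all add: algebra_simps)
    then show ?thesis by (simp add: base_def S_def \<gamma>_def algebra_simps)
  qed
  have addr: "base k j + 2 * c + 1 < S" if "k \<le> L" "j < \<gamma>" "c < 2 * \<tau>" for k j c
    using base_bound[OF that(1,2)] that(3) by linarith
  have cell: "cell (base k j + 2 * c) = ptr k j c" "cell (base k j + 2 * c + 1) = shift k j c"
    if "j < \<gamma>" "c < 2 * \<tau>" for k j c
  proof -
    define y where "y = 2 * \<tau> * (k * \<gamma> + j) + c"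
    have b: "base k j + 2 * c = 2 + 2 * y"
      by (simp add: base_def y_def algebra_simps)
    have "y div (2 * \<tau>) = k * \<gamma> + j" "y mod (2 * \<tau>) = c"
      using that unfolding y_def
      by (simp_all only: div_mult_self4 mod_mult_self4 div_less mod_less)
    moreover have "(k * \<gamma> + j) div \<gamma> = k" "(k * \<gamma> + j) mod \<gamma> = j" using that by simp_all
    ultimately show "cell (base k j + 2 * c) = ptr k j c"
      "cell (base k j + 2 * c + 1) = shift k j c"
      unfolding cell_def b Let_def by simp_all
  qed
  have D_cell: "D ! (base k j + 2 * c) = ptr k j c" "D ! (base k j + 2 * c + 1) = shift k j c"
    if "k \<le> L" "j < \<gamma>" "c < 2 * \<tau>" for k j c
    using addr[OF that] cell[OF that(2,3)] by (simp_all add: D_def base_def)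

  have ptr_less: "ptr k j c < 2 ^ w" for k j c
  proof -
    have "base (Suc k) (J k s) < 2 ^ w" if "k < L" "s < n" for s
      using base_bound[of "Suc k" "J k s"] that JO(1)[of s k] S w \<tau> by linarith
    moreover have "code (T ! s) < 2 ^ w" if "s < n" for s
      using code that nth_mem[of s T] unfolding n_def by blast
    ultimately show ?thesis by (simp add: ptr_def Let_def)
  qed
  have shift_less: "shift k j c < 2 ^ w" for k j c
  proof -
    have "O' k s - x < 2 ^ w" if "s < n" for s x
      using JO(4)[OF that, of k] w unfolding n_def by linarith
    then show ?thesis by (simp add: shift_def Let_def)
  qed
  have "\<tau> \<le> S"
    using base_bound[of 0 0] \<gamma>_pos by simp
  then have "\<tau> < 2 ^ w" using S w by linarith
  moreover have "q 0 < 2 ^ w" using q_le[of 0] w unfolding n_def by linarith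
  ultimately have D_less: "set D \<subseteq> {..<2 ^ w}"
    using ptr_less shift_less by (auto simp: D_def cell_def Let_def)

  \<comment> \<open>Induction on the number \<open>d\<close> of levels below the current one. At
    \<open>d = 0\<close> blocks are single characters and the cell holds the code itself.\<close>
  have loop: "let s' = (step w access_prog ^^ (11 * (d + 1))) s
      in pc s' = 18 \<and> reg s' 0 = code (T ! (st k j + r)) \<and> mem s' = m"
    if m: "\<forall>a<S. m a = D ! a"
      and "loop_state m \<tau> (base k j) (q k) r s" "k + d = L" "j < \<gamma>"
        "r < 2 * \<tau> * q k" "st k j + r < n" for m d k j r s
    using that(2-)
  proof (induction d arbitrary: k j r s)
    case 0
    then have k: "k = L" by simp
    have q1: "q k = 1" by (simp add: q_def k)
    have r: "r < 2 * \<tau>" using 0 q1 by simp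
    have "base k j + 2 * (r div q k) + 1 < 2 ^ w"
      using addr[of k j r] k 0 r S w q1 by simp
    moreover have "q k div \<tau> = 0" using \<tau> q1 by simp
    moreover have "m (base k j + 2 * (r div q k)) = code (T ! (st k j + r))"
      using D_cell(1)[of k j r] addr[of k j r] k 0 r q1 m by (simp add: ptr_def)
    ultimately show ?case
      using access_prog_exit[OF 0(1)] by simp
  next
    case (Suc d)
    define c where "c = r div q k"
    define x where "x = r mod q k"
    define s0 where "s0 = st k j + c * q k"
    have k: "k < L" using Suc.prems by simp
    have c: "c < 2 * \<tau>" using Suc.prems(4) q_pos[of k] by (simp add: c_def less_mult_imp_div_less)
    have r: "r = c * q k + x" by (simp add: c_def x_def)
    have s0: "s0 < n" "s0 + x < n" "st k j + r = s0 + x"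
      using Suc.prems(5) r by (simp_all add: s0_def)
    have x: "x < q k" "x < min (q k) (n - s0)" using q_pos[of k] s0 by (auto simp: x_def)
    define p where "p = pts ! J k s0"
    have jump: "J k s0 < \<gamma>" "O' k s0 \<le> p" "p < O' k s0 + q k" "O' k s0 + x < n"
      "T ! (O' k s0 + x) = T ! (s0 + x)"
      using JO(1,2)[OF s0(1), of k] JO(3)[OF s0(1), of k] JO(4)[OF s0(1), of k] JO(5)[OF s0(1) x(2)]
        x(2) unfolding p_def by linarith+
    have st: "st (Suc k) (J k s0) = p - q k" by (simp add: st_def p_def)
    define r' where "r' = x + shift k j c"
    have shift: "shift k j c = O' k s0 - (p - q k)"
      using s0(1) k by (simp add: shift_def st flip: s0_def)
    \<comment> \<open>The occurrence of the block covers or ends past \<open>p\<close>, so it starts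
      between \<open>p - q k\<close> and \<open>p\<close>: the subtraction in the shift is exact,
      and the shift is at most \<open>q k\<close>.\<close>
    have r': "st (Suc k) (J k s0) + r' = O' k s0 + x" "r' < 2 * q k"
      using jump(2,3) x(1) unfolding r'_def shift st by linarith+
    have a: "base k j + 2 * c + 1 < S" using addr c k Suc.prems by simp
    have m1: "m (base k j + 2 * c) = base (Suc k) (J k s0)"
      using D_cell(1)[of k j c] a c k Suc.prems m s0(1) by (simp add: ptr_def flip: s0_def)
    have m2: "m (base k j + 2 * c + 1) = shift k j c"
      using D_cell(2)[of k j c] a c k Suc.prems m by simp
    have qd: "q k div \<tau> = q (Suc k)" using q_Suc[OF k] \<tau> by simp
    have "loop_state m \<tau> (m (base k j + 2 * (r div q k))) (q k div \<tau>)
        (r mod q k + m (base k j + 2 * (r div q k) + 1)) ((step w access_prog ^^ 11) s)"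
    proof (rule access_prog_loop[OF Suc.prems(1)])
      show "base k j + 2 * (r div q k) + 1 < 2 ^ w" using a S w by (simp flip: c_def)
      show "r mod q k + m (base k j + 2 * (r div q k) + 1) < 2 ^ w"
        using r'(2) q_le[of k] w m2 unfolding n_def r'_def c_def x_def by linarith
      show "q k div \<tau> \<noteq> 0" using qd q_pos[of "Suc k"] by simp
    qed
    then have "loop_state m \<tau> (base (Suc k) (J k s0)) (q (Suc k)) r' ((step w access_prog ^^ 11) s)"
      using m1 m2 qd by (simp add: r'_def c_def x_def)
    then have "let s' = (step w access_prog ^^ (11 * (d + 1))) ((step w access_prog ^^ 11) s)
      in pc s' = 18 \<and> reg s' 0 = code (T ! (st (Suc k) (J k s0) + r')) \<and> mem s' = m"
      using Suc.prems jump r' q_Suc[OF k] by (intro Suc.IH) (simp_all add: mult.assoc)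
    moreover have "(step w access_prog ^^ (11 * (d + 1))) ((step w access_prog ^^ 11) s) =
        (step w access_prog ^^ (11 * (Suc d + 1))) s"
      using funpow_add[of "11 * (d + 1)" 11 "step w access_prog"] by (simp add: algebra_simps)
    ultimately show ?case using r'(1) jump(5) s0(3) by simp
  qed

  have "query_returns w access_prog D i (code (T ! (i - 1))) (6 + 11 * (L + 1))"
    if i: "i \<in> {1..length T}" for i
    unfolding query_returns_def
  proof (intro allI impI)
    fix m :: "nat \<Rightarrow> nat"
    assume "(\<forall>k. m k < 2 ^ w) \<and> (\<forall>k<length D. m k = D ! k)"
    then have m: "\<forall>a<S. m a = D ! a" by (simp add: len)
    have S2: "2 < S" using base_bound[of 0 0] \<gamma>_pos \<tau> by simp
    have m01: "m 0 = q 0" "m 1 = \<tau>" using m S2 by (simp_all add: D_def)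
    let ?s = "\<lparr>pc = 0, reg = (\<lambda>_. 0)(0 := i), mem = m\<rparr>"
    have init: "loop_state m \<tau> (base 0 0) (q 0) (i - 1) ((step w access_prog ^^ 6) ?s)"
      using access_prog_init[of m i w] m01 q_pos[of 0] i w S S2 by (simp add: base_def)
    \<comment> \<open>The query enters at table \<open>0\<close> of level \<open>0\<close>, whose
      window starts at \<open>0\<close> and has length
      \<open>2 * \<tau> ^ (L + 1) > n\<close>.\<close>
    have "i - 1 < n" "i - 1 < 2 * \<tau> * q 0"
      using i n_less unfolding n_def q_def by (auto simp: mult.assoc)
    then have fin: "let s' = (step w access_prog ^^ (11 * (L + 1))) ((step w access_prog ^^ 6) ?s)
      in pc s' = 18 \<and> reg s' 0 = code (T ! (st 0 0 + (i - 1))) \<and> mem s' = m"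
      using \<gamma>_pos by (intro loop[OF m init]) (simp_all add: st_def)
    have "(step w access_prog ^^ (6 + 11 * (L + 1))) ?s =
        (step w access_prog ^^ (11 * (L + 1))) ((step w access_prog ^^ 6) ?s)"
      using funpow_add[of "11 * (L + 1)" 6 "step w access_prog"] by (simp add: add.commute)
    then show "let s = (step w access_prog ^^ (6 + 11 * (L + 1))) ?s
        in halted access_prog s \<and> reg s 0 = code (T ! (i - 1)) \<and> (\<forall>k<length D. mem s k = D ! k)"
      using fin m by (simp add: Let_def halted_def access_prog_def len st_def)
  qed
  then show ?thesis using len D_less by blast
qed

text \<open>The leading \<open>0\<close> selects the explicit branch and also moves the
  \<open>i\<close>-th character, counted from 1, to address \<open>i\<close>.\<close>

lemma explicit_access_structure:
  assumes "i \<in> {1..length T}"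
  shows "query_returns w access_prog (0 # map code T) i (code (T ! (i - 1))) 3"
  unfolding query_returns_def
proof (intro allI impI)
  fix m :: "nat \<Rightarrow> nat"
  assume "(\<forall>k. m k < 2 ^ w) \<and> (\<forall>k<length (0 # map code T). m k = (0 # map code T) ! k)"
  then have m: "m k = (0 # map code T) ! k" if "k < length T + 1" for k using that by simp
  have "m 0 = 0" "m i = code (T ! (i - 1))"
    using m[of 0] m[of i] assms by (auto simp: nth_Cons')
  then show "let s = (step w access_prog ^^ 3) \<lparr>pc = 0, reg = (\<lambda>_. 0)(0 := i), mem = m\<rparr>
    in halted access_prog s \<and> reg s 0 = code (T ! (i - 1)) \<and>
       (\<forall>k<length (0 # map code T). mem s k = (0 # map code T) ! k)"
    using m access_prog_explicit[of m w i] by (simp add: halted_def access_prog_def)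
qed

section \<open>Choice of the branching factor\<close>

lemma lg_ge_1: "1 \<le> lg x" by (simp add: lg_def)

text \<open>The tangent of \<open>ln\<close> at 2 gives \<open>ln x \<le> x / 2\<close>, and
  \<open>ln 2\<close> is at least 1/2. Applied to \<open>lg n\<close>, this makes
  \<open>lg n / lg (lg n)\<close> at least 1.\<close>

lemma lg_le_self: "1 \<le> x \<Longrightarrow> lg x \<le> x"
proof -
  assume "1 \<le> x"
  have half: "1 / 2 \<le> ln (2::real)" using ln_le_minus_one[of "1 / 2"] by (simp add: ln_div)
  have "ln x - ln 2 \<le> x / 2 - 1"
    using ln_le_minus_one[of "x / 2"] \<open>1 \<le> x\<close> by (simp add: ln_div)
  then have "ln x \<le> x * (1 / 2)" using ln_2_less_1 by simp
  also have "\<dots> \<le> x * ln 2" using half \<open>1 \<le> x\<close> by (intro mult_left_mono) auto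
  finally have "ln x \<le> x * ln 2" .
  then show ?thesis using \<open>1 \<le> x\<close> by (simp add: lg_def log_def field_simps)
qed

text \<open>Taking logarithms of \<open>\<tau> ^ L \<le> n\<close> bounds \<open>L\<close> by
  \<open>lg n / log 2 \<tau>\<close>; the summand 2 in \<open>\<tau>\<close> ensures
  \<open>log 2 \<tau> \<ge> 1\<close>, the other one
  \<open>log 2 \<tau> \<ge> \<epsilon> * log 2 (lg n)\<close>.\<close>

lemma levels_bounds:
  fixes \<epsilon> :: real and n L :: nat
  defines "\<tau> \<equiv> 2 + nat \<lfloor>lg n powr \<epsilon>\<rfloor>"
  assumes \<epsilon>: "\<epsilon> > 0" and L: "\<tau> ^ L \<le> n"
  shows "real L \<le> lg n" "real \<tau> \<le> 3 * lg n powr \<epsilon>"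
    "real L \<le> 1 / min \<epsilon> 1 * (lg n / lg (lg n))"
proof -
  have x: "1 \<le> lg n powr \<epsilon>" using \<epsilon> lg_ge_1 by (simp add: ge_one_powr_ge_zero)
  then show "real \<tau> \<le> 3 * lg n powr \<epsilon>" unfolding \<tau>_def by linarith
  have \<tau>: "lg n powr \<epsilon> \<le> \<tau>" "2 \<le> real \<tau>" unfolding \<tau>_def using x by linarith+
  have n: "1 \<le> n" using L one_le_power[of \<tau> L] unfolding \<tau>_def by linarith
  have "real \<tau> ^ L \<le> real n" using L by (metis of_nat_le_iff of_nat_power)
  then have "log 2 (real \<tau> ^ L) \<le> log 2 n" using \<tau> n by simp
  then have Lle: "real L * log 2 \<tau> \<le> lg n" using \<tau>(2) by (simp add: log_nat_power lg_def)
  have 1: "1 \<le> log 2 \<tau>" using \<tau>(2) by simp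
  show "real L \<le> lg n"
    using mult_left_mono[OF 1, of "real L"] Lle by simp
  have "log 2 (lg n powr \<epsilon>) \<le> log 2 \<tau>" using \<tau> x by (intro log_mono) auto
  then have 2: "\<epsilon> * log 2 (lg n) \<le> log 2 \<tau>" using lg_ge_1[of n] by (simp add: log_powr)
  \<comment> \<open>Where \<open>lg (lg n)\<close> is clamped to 1, only
    \<open>log 2 \<tau> \<ge> 1\<close> helps; hence the factor is capped at 1.\<close>
  have "min \<epsilon> 1 * lg (lg n) \<le> log 2 \<tau>"
  proof (cases "log 2 (lg n) \<le> 1")
    case True
    then show ?thesis using 1 by (simp add: lg_def[of "lg n"])
  next
    case False
    then have "min \<epsilon> 1 * log 2 (lg n) \<le> \<epsilon> * log 2 (lg n)" by (intro mult_right_mono) auto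
    then have "min \<epsilon> 1 * log 2 (lg n) \<le> log 2 \<tau>" using 2 by linarith
    then show ?thesis using False by (simp add: lg_def[of "lg n"])
  qed
  then have "real L * (min \<epsilon> 1 * lg (lg n)) \<le> lg n"
    using Lle mult_left_mono[of _ _ "real L"] by (meson of_nat_0_le_iff order_trans)
  moreover have "0 < min \<epsilon> 1 * lg (lg n)" using \<epsilon> lg_ge_1[of "lg n"] by simp
  ultimately have "real L \<le> lg n / (min \<epsilon> 1 * lg (lg n))" by (simp add: pos_le_divide_eq)
  then show "real L \<le> 1 / min \<epsilon> 1 * (lg n / lg (lg n))" by simp
qed

section \<open>Combining both storage schemes\<close>

theorem theorem5p4:
  fixes \<epsilon> :: real
  assumes "\<epsilon> > 0"
  shows "\<exists>(P :: instr list) (C :: real).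
    \<forall>(G :: 's slp) (T :: 's list) (n :: nat) (w :: nat) (code :: 's \<Rightarrow> nat).
      is_slp G \<and> slp_string G = T \<and> length T = n \<and>
      n < 2 ^ w \<and> inj_on code (terms G) \<and> code ` terms G \<subseteq> {..<2 ^ w} \<longrightarrow>
      (\<exists>D :: nat list.
         set D \<subseteq> {..<2 ^ w} \<and>
         real (length D) \<le> C * real (slp_size G) * lg (real n) powr (1 + \<epsilon>) \<and>
         (\<forall>i\<in>{1..n}. \<exists>t :: nat.
            real t \<le> C * (lg (real n) / lg (lg (real n))) \<and>
            query_returns w P D i (code (T ! (i - 1))) t))"
proof -
  \<comment> \<open>The size needs 26 = 2 + 4 * 3 * 2, from
    \<open>\<tau> \<le> 3 * lg n powr \<epsilon>\<close> and \<open>L + 1 \<le> 2 * lg n\<close>;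
    the time needs 17 + 11 / \<open>min \<epsilon> 1\<close>, where 17 = 6 + 11.\<close>
  define C where "C = 26 + 11 / min \<epsilon> 1"
  have C: "26 \<le> C" using assms by (simp add: C_def)
  show ?thesis
  proof (rule exI[of _ access_prog], rule exI[of _ C], intro allI impI, elim conjE)
    fix G :: "'s slp" and T :: "'s list" and n w :: nat and code :: "'s \<Rightarrow> nat"
    assume G: "is_slp G" and T: "slp_string G = T" and n: "length T = n" and w: "n < 2 ^ w"
      and code: "code ` terms G \<subseteq> {..<2 ^ w}"
    have ratio: "1 \<le> lg n / lg (lg n)"
      using lg_le_self[OF lg_ge_1, of n] lg_ge_1[of "lg n"] by (simp add: le_divide_eq)
    have "start G \<in> nonterms G" using G unfolding is_slp_def by blast
    then have "set T \<subseteq> terms G" using expansion_props(1)[OF G] T unfolding slp_string_def by blast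
    then have codeT: "code ` set T \<subseteq> {..<2 ^ w}" using code by blast
    obtain \<Gamma> where \<Gamma>: "finite \<Gamma>" "card \<Gamma> \<le> slp_size G" "attractor T \<Gamma>"
      using slp_attractor[OF G] T by blast
    obtain pts where pts: "set pts = \<Gamma>" "length pts = card \<Gamma>"
      using finite_distinct_list[OF \<Gamma>(1)] distinct_card by metis
    define g where "g = slp_size G"
    have "finite (nonterms G)" using G unfolding is_slp_def by blast
    then have "0 < card (nonterms G)" using \<open>start G \<in> nonterms G\<close> card_gt_0_iff by blast
    then have g: "1 \<le> g" using card_nonterms_le_slp_size[of G] unfolding g_def by linarith
    define \<tau> where "\<tau> = 2 + nat \<lfloor>lg n powr \<epsilon>\<rfloor>"
    have \<tau>: "2 \<le> \<tau>" by (simp add: \<tau>_def)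

    let ?Q = "\<exists>D :: nat list.
         set D \<subseteq> {..<2 ^ w} \<and>
         real (length D) \<le> C * real (slp_size G) * lg (real n) powr (1 + \<epsilon>) \<and>
         (\<forall>i\<in>{1..n}. \<exists>t :: nat.
            real t \<le> C * (lg (real n) / lg (lg (real n))) \<and>
            query_returns w access_prog D i (code (T ! (i - 1))) t)"
    have explicit: ?Q if "real (n + 1) \<le> C * real g * lg n powr (1 + \<epsilon>)"
    proof (intro exI[of _ "0 # map code T"] conjI ballI)
      fix i assume "i \<in> {1..n}"
      then have "query_returns w access_prog (0 # map code T) i (code (T ! (i - 1))) 3"
        using n by (intro explicit_access_structure) auto
      moreover have "real 3 \<le> C * (lg n / lg (lg n))"
        using mult_mono[OF C ratio] C by simp
      ultimately show "\<exists>t. real t \<le> C * (lg n / lg (lg n)) \<and>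
        query_returns w access_prog (0 # map code T) i (code (T ! (i - 1))) t" by blast
    qed (use codeT n that in \<open>auto simp: g_def\<close>)

    show ?Q
    proof (cases "n < 2")
      \<comment> \<open>No \<open>L\<close> satisfies \<open>2 * \<tau> ^ L \<le> n\<close> here,
        but the explicit form has at most two words.\<close>
      case True
      have "1 * 1 \<le> real g * lg n powr (1 + \<epsilon>)"
        using g assms lg_ge_1[of n] by (intro mult_mono ge_one_powr_ge_zero) auto
      then have "26 * 1 \<le> C * (real g * lg n powr (1 + \<epsilon>))" using C by (intro mult_mono) auto
      then show ?thesis using True by (intro explicit) (simp add: mult.assoc)
    next
      case False
      obtain L where "\<tau> ^ L \<le> n div 2" "n div 2 < \<tau> ^ (L + 1)"
        using ex_power_ivl1[OF \<tau>, of "n div 2"] False div_le_mono[of 2 n 2] by auto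
      then have L: "2 * \<tau> ^ L \<le> n" "n < 2 * \<tau> ^ (L + 1)" by linarith+
      have L': "\<tau> ^ L \<le> n" using L by simp
      note bounds = levels_bounds[OF assms L'[unfolded \<tau>_def], folded \<tau>_def]
      define S where "S = 2 + 4 * \<tau> * (length pts * (L + 1))"
      have S_le: "real S \<le> 26 * (real g * lg n powr (1 + \<epsilon>))"
      proof -
        have "real (length pts * (L + 1)) \<le> real g * (2 * lg n)"
          using \<Gamma>(2) pts(2) bounds(1) lg_ge_1[of n]
          unfolding of_nat_mult g_def by (intro mult_mono) auto
        then have "real (4 * \<tau>) * real (length pts * (L + 1)) \<le>
            (4 * (3 * lg n powr \<epsilon>)) * (real g * (2 * lg n))"
          using bounds(2) lg_ge_1[of n] by (intro mult_mono) auto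
        also have "\<dots> = 24 * (real g * lg n powr (1 + \<epsilon>))"
          using lg_ge_1[of n] by (simp add: powr_add)
        finally have "real S \<le> 2 + 24 * (real g * lg n powr (1 + \<epsilon>))"
          by (simp add: S_def)
        moreover have "1 * 1 \<le> real g * lg n powr (1 + \<epsilon>)"
          using g assms lg_ge_1[of n] by (intro mult_mono ge_one_powr_ge_zero) auto
        ultimately show ?thesis by simp
      qed
      also have "\<dots> \<le> C * (real g * lg n powr (1 + \<epsilon>))" using C by (intro mult_right_mono) auto
      finally have S_C: "real S \<le> C * real g * lg n powr (1 + \<epsilon>)" by (simp add: mult.assoc)
      show ?thesis
      proof (cases "S \<le> n")
        \<comment> \<open>\<open>n < S\<close> means \<open>n + 1 \<le> S\<close>, so the flag word
          still fits the size bound.\<close>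
        case False
        then show ?thesis using S_C by (intro explicit) linarith
      next
        case True
        then obtain D where D: "length D = S" "set D \<subseteq> {..<2 ^ w}"
          "\<forall>i\<in>{1..n}. query_returns w access_prog D i (code (T ! (i - 1))) (6 + 11 * (L + 1))"
          using attractor_access_structure[of T pts \<tau> L w code] \<Gamma>(3) pts(1) \<tau> L w codeT n
          unfolding S_def by auto
        have "real (6 + 11 * (L + 1)) = 17 + 11 * real L" by simp
        also have "\<dots> \<le> 17 * (lg n / lg (lg n)) + 11 * (1 / min \<epsilon> 1 * (lg n / lg (lg n)))"
          using bounds(3) ratio by (intro add_mono mult_left_mono) auto
        also have "\<dots> = (17 + 11 / min \<epsilon> 1) * (lg n / lg (lg n))" by (simp add: algebra_simps)
        also have "\<dots> \<le> C * (lg n / lg (lg n))"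
          using ratio by (intro mult_right_mono) (auto simp: C_def)
        finally show ?thesis using D S_C unfolding g_def by blast
      qed
    qed
  qed
qed

end
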